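(* Let $\mathbb{F}_q$ be a finite field with $q>2$ elements, and let $a$ and $b$ be two different elements of $\mathbb{F}_q$. Then the polynomial $$f_{a,b}(x)=(b-a)\Big(\Big(\frac{x-a}{b-a}\Big)^{q-2}+ \cdots+\Big(\frac{x-a}{b-a}\Big)^2+2\Big(\frac{x-a}{b-a}\Big)+1\Big)+a \in \mathbb{F}_q[x]$$ represents the transposition $(ab)$ of $\mathbb{F}_q$.
   Context: A polynomial $f\in\mathbb{F}_q[x]$ represents (or induces) a permutation $\sigma$ of $\mathbb{F}_q$ if $f(c)=\sigma(c)$ for every $c\in\mathbb{F}_q$. The transposition $(ab)$ interchanges $a$ and $b$ and fixes every other element of $\mathbb{F}_q$. With $y=\frac{x-a}{b-a}$, the inner expression $y^{q-2}+\cdots+y^2+2y+1$ denotes $y+\sum_{i=0}^{q-2}y^i$ (so for $q=3$ it is $2y+1$). *)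

theory Defs
  imports
    "HOL-Computational_Algebra.Polynomial"
    "HOL-Combinatorics.Transposition"
    "HOL-Library.Cardinality"
begin

text \<open>A finite field with \<open>q\<close> elements is a type \<open>'a :: {finite, field}\<close> with \<open>q = CARD('a)\<close>.\<close>

definition represents :: "'a :: {finite, field} poly \<Rightarrow> ('a \<Rightarrow> 'a) \<Rightarrow> bool" where
  "represents f \<sigma> \<longleftrightarrow> bij \<sigma> \<and> (\<forall>c. poly f c = \<sigma> c)"

text \<open>
  The inner expression \<open>y^(q-2) + ... + y^2 + 2y + 1\<close> is \<open>y\<close> plus the sum of all \<open>y^i\<close> for
  \<open>i = 0, ..., q-2\<close>, where \<open>y = (x - a) / (b - a)\<close> is itself a polynomial in \<open>x\<close>.
\<close>
definition transposition_poly :: "'a :: {finite, field} \<Rightarrow> 'a \<Rightarrow> 'a poly" where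
  "transposition_poly a b =
     (let y = smult (1 / (b - a)) [:- a, 1:]
      in smult (b - a) (y + (\<Sum>i=0..CARD('a) - 2. y ^ i)) + [:a:])"

end

theory Submission
  imports Defs
begin

text \<open>
  Put \<open>y = (x - a) / (b - a)\<close>. This affine change of variable carries \<open>a, b\<close> to \<open>0, 1\<close>, so the
  claim reduces to showing that \<open>y + S(y)\<close>, with \<open>S(y) = 1 + y + \<dots> + y^(q-2)\<close>, swaps \<open>0\<close> and \<open>1\<close>
  and fixes every other element. For \<open>y \<noteq> 1\<close> the geometric sum gives
  \<open>(y - 1) * S(y) = y^(q-1) - 1\<close>, which vanishes for \<open>y \<noteq> 0\<close> by Fermat's little theorem for finite
  fields (\<open>power_card_minus_1\<close>); hence \<open>S\<close> vanishes outside \<open>{0, 1}\<close>. At the two exceptional points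
  \<open>S(0) = 1\<close>, and \<open>S(1) = q - 1 = -1\<close> because the field has characteristic dividing \<open>q\<close>
  (\<open>of_nat_card_eq_0\<close>). Thus \<open>S\<close> is precisely the correction \<open>0 \<mapsto> 1\<close>, \<open>1 \<mapsto> -1\<close> that turns the
  identity into the transposition.
\<close>

text \<open>
  The sum of all elements of the ring is invariant under the shift \<open>x \<mapsto> x + 1\<close>, which adds \<open>1\<close>
  to each of the \<open>q\<close> summands.
\<close>
lemma of_nat_card_eq_0: "of_nat CARD('a) = (0 :: 'a :: {finite, ring_1})"
proof -
  have "bij (\<lambda>x :: 'a. x + 1)"
    by (rule bij_betw_byWitness[where f' = "\<lambda>x. x - 1"]) auto
  then have "(\<Sum>x::'a\<in>UNIV. x + 1) = (\<Sum>x::'a\<in>UNIV. x)"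
    by (rule sum.reindex_bij_betw)
  then show ?thesis
    by (simp add: sum.distrib)
qed

text \<open>
  Multiplication by \<open>y \<noteq> 0\<close> permutes the nonzero elements, so it does not change their product,
  while it multiplies that product by \<open>y^(q-1)\<close>.
\<close>
lemma power_card_minus_1:
  fixes y :: "'a :: {finite, field}"
  assumes "y \<noteq> 0"
  shows "y ^ (CARD('a) - 1) = 1"
proof -
  let ?P = "\<Prod>x\<in>UNIV - {0 :: 'a}. x"
  have "bij_betw (\<lambda>x. y * x) (UNIV - {0}) (UNIV - {0})"
    by (rule bij_betw_byWitness[where f' = "\<lambda>x. x / y"]) (use assms in auto)
  then have "(\<Prod>x\<in>UNIV - {0}. y * x) = ?P"
    by (rule prod.reindex_bij_betw)
  then have "y ^ (CARD('a) - 1) * ?P = ?P"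
    by (simp add: prod.distrib card_Diff_singleton)
  moreover have "?P \<noteq> 0"
    by simp
  ultimately show ?thesis
    by simp
qed

lemma sum_powers_finite_field:
  fixes y :: "'a :: {finite, field}"
  shows "(\<Sum>i<CARD('a) - 1. y ^ i) = (if y = 0 then 1 else if y = 1 then - 1 else 0)"
proof -
  have q: "CARD('a) > 1"
    using card_mono[of UNIV "{0, 1 :: 'a}"] by simp
  consider "y = 0" | "y = 1" | "y \<noteq> 0" "y \<noteq> 1"
    by blast
  then show ?thesis
  proof cases
    case 1
    then show ?thesis
      using q by (simp add: power_0_left)
  next
    case 2
    then show ?thesis
      using q of_nat_card_eq_0[where ?'a = 'a] by (simp add: of_nat_diff)
  next
    case 3
    then show ?thesis
      using power_diff_1_eq[of y "CARD('a) - 1"] power_card_minus_1[of y] by simp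
  qed
qed

lemma poly_transposition_poly:
  fixes a b c :: "'a :: {finite, field}"
  defines "y \<equiv> (c - a) / (b - a)"
  assumes "CARD('a) > 2"
  shows "poly (transposition_poly a b) c = (b - a) * (y + (\<Sum>i<CARD('a) - 1. y ^ i)) + a"
proof -
  have "{0..CARD('a) - 2} = {..<CARD('a) - 1}"
    using assms(2) by auto
  moreover have "poly (smult (1 / (b - a)) [:- a, 1:]) c = y"
    by (simp add: y_def flip: diff_divide_distrib)
  ultimately show ?thesis
    unfolding transposition_poly_def Let_def
    by (simp only: poly_add poly_smult poly_sum poly_power poly_pCons poly_0 mult_zero_right add_0_right)
qed

theorem theorem1:
  fixes a b :: "'a :: {finite, field}"
  assumes "CARD('a) > 2"
    and "a \<noteq> b"
  shows "represents (transposition_poly a b) (transpose a b)"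
proof -
  have "poly (transposition_poly a b) c = transpose a b c" for c
  proof -
    let ?y = "(c - a) / (b - a)"
    have "?y = 0 \<longleftrightarrow> c = a" "?y = 1 \<longleftrightarrow> c = b" "(b - a) * ?y = c - a"
      using assms(2) by auto
    then show ?thesis
      unfolding poly_transposition_poly[OF assms(1)] sum_powers_finite_field
      using assms(2) by (auto simp: transpose_def)
  qed
  then show ?thesis
    by (simp add: represents_def)
qed

end
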